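(* Let $\lambda>0$, $\mu>0$, $c>0$. Let $p_h(\mathbf x)$ be the stationary density (as defined in the context) of the symmetric planar Markov random flight with speed $c$ and switching rate $\lambda$ whose lifetime is exponentially distributed with parameter $\mu$, that is, $$p_h(\mathbf x)=\frac{\lambda\mu}{2\pi c}\int_{\Vert\mathbf x\Vert/c}^{\infty} e^{-(\lambda+\mu)\tau}\,\frac{\exp\left(\frac{\lambda}{c}\sqrt{c^2\tau^2-\Vert\mathbf x\Vert^2}\right)}{\sqrt{c^2\tau^2-\Vert\mathbf x\Vert^2}}\,d\tau .$$ Then for every $\mathbf x\in\mathbb R^2$ with $\mathbf x\neq \mathbf 0$, $$p_h(\mathbf x)=\frac{\lambda\mu}{2\pi^{3/2}c^2}\sum_{k=0}^{\infty}\frac{\lambda^k}{k!}\,\Gamma\left(\frac{k+1}{2}\right)\left(\frac{2\Vert\mathbf x\Vert}{c(\lambda+\mu)}\right)^{k/2}K_{k/2}\left((\lambda+\mu)\frac{\Vert\mathbf x\Vert}{c}\right),$$ where $K_{k/2}(z)$ is the McDonald function of order $k/2$.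
   Context: For $\mathbf x=(x_1,x_2)\in\mathbb R^2$, $\Vert\mathbf x\Vert=\sqrt{x_1^2+x_2^2}$. The symmetric planar Markov random flight is the process in which a particle starts at the origin of $\mathbb R^2$ at time $0$ and moves with constant speed $c>0$. Its initial direction is uniform on the unit circle, and at the events of a homogeneous Poisson process of rate $\lambda>0$ it takes a new direction, uniform on the unit circle and independent of its previous direction. The absolutely continuous part of its transition density at time $t>0$ is $$p^{(ac)}(\mathbf x,t)=\frac{\lambda}{2\pi c}\,\frac{\exp\left(-\lambda t+\frac{\lambda}{c}\sqrt{c^2t^2-\Vert\mathbf x\Vert^2}\right)}{\sqrt{c^2t^2-\Vert\mathbf x\Vert^2}}\,\Theta(ct-\Vert\mathbf x\Vert),$$ where $\Theta$ is the Heaviside unit-step function. If the lifetime of the particle is a positive random variable with density $q$, the stationary density is by definition $p(\mathbf x)=\int_0^\infty p^{(ac)}(\mathbf x,\tau)\,q(\tau)\,d\tau$ (the singular part of the transition density, concentrated on the circle of radius $ct$, is ignored). For $p_h$ the lifetime density is exponential: $q(t)=\mu e^{-\mu t}$ for $t\ge 0$ and $q(t)=0$ for $t<0$; this gives the integral in the claim. The McDonald function $K_\nu$ is the modified Bessel function of the second kind of order $\nu$, and $\Gamma$ is the Euler gamma function. *)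

theory Defs
  imports "HOL-Probability.Probability"
begin

definition heaviside :: "real \<Rightarrow> real" where
  "heaviside u = (if u < 0 then 0 else 1)"

text \<open>
  Absolutely continuous part of the transition density, at time \<open>t > 0\<close>, of the symmetric
  planar Markov random flight with speed \<open>c\<close> and switching rate \<open>lam\<close>.  The value on the circle
  of radius \<open>c * t\<close> is \<open>0\<close> by the division convention; it does not affect integrals over time.
\<close>

definition flight_ac_density :: "real \<Rightarrow> real \<Rightarrow> real ^ 2 \<Rightarrow> real \<Rightarrow> real" where
  "flight_ac_density c lam x t =
     lam / (2 * pi * c) *
     (exp (- lam * t + lam / c * sqrt (c\<^sup>2 * t\<^sup>2 - (norm x)\<^sup>2)) / sqrt (c\<^sup>2 * t\<^sup>2 - (norm x)\<^sup>2)) *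
     heaviside (c * t - norm x)"

definition stationary_density :: "real \<Rightarrow> real \<Rightarrow> (real \<Rightarrow> real) \<Rightarrow> real ^ 2 \<Rightarrow> real" where
  "stationary_density c lam q x = (LBINT \<tau>:{0..}. flight_ac_density c lam x \<tau> * q \<tau>)"

definition p_h :: "real \<Rightarrow> real \<Rightarrow> real \<Rightarrow> real ^ 2 \<Rightarrow> real" where
  "p_h c lam \<mu> = stationary_density c lam (exponential_density \<mu>)"

lemma p_h_eq_integral:
  assumes "lam > 0" "\<mu> > 0" "c > 0"
  shows "p_h c lam \<mu> x = lam * \<mu> / (2 * pi * c) *
    (LBINT \<tau>:{norm x / c..}. exp (- (lam + \<mu>) * \<tau>) *
       (exp (lam / c * sqrt (c\<^sup>2 * \<tau>\<^sup>2 - (norm x)\<^sup>2)) / sqrt (c\<^sup>2 * \<tau>\<^sup>2 - (norm x)\<^sup>2)))"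
proof -
  have pt: "indicator {0..} \<tau> * (flight_ac_density c lam x \<tau> * exponential_density \<mu> \<tau>) =
      lam * \<mu> / (2 * pi * c) * (indicator {norm x / c..} \<tau> * (exp (- (lam + \<mu>) * \<tau>) *
       (exp (lam / c * sqrt (c\<^sup>2 * \<tau>\<^sup>2 - (norm x)\<^sup>2)) / sqrt (c\<^sup>2 * \<tau>\<^sup>2 - (norm x)\<^sup>2))))"
    for \<tau> :: real
  proof (cases "norm x / c \<le> \<tau>")
    case True
    moreover have "0 \<le> norm x / c" using assms by simp
    ultimately have "0 \<le> \<tau>" and "norm x \<le> c * \<tau>"
      using assms by (linarith, simp add: field_simps)
    moreover have "exp (- (lam + \<mu>) * \<tau>) = exp (- lam * \<tau>) * exp (- \<tau> * \<mu>)"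
      by (simp add: algebra_simps flip: exp_add)
    ultimately show ?thesis using True
      by (simp add: flight_ac_density_def heaviside_def exponential_density_def exp_diff exp_minus field_simps)
  next
    case False
    then have "c * \<tau> < norm x" using assms by (simp add: field_simps)
    then show ?thesis using False by (simp add: flight_ac_density_def heaviside_def)
  qed
  show ?thesis
    unfolding p_h_def stationary_density_def set_lebesgue_integral_def real_scaleR_def
    by (simp only: pt integral_mult_right_zero)
qed

definition bessel_I :: "real \<Rightarrow> real \<Rightarrow> real" where
  "bessel_I \<nu> z = (\<Sum>m. rGamma (real m + \<nu> + 1) / fact m * (z / 2) powr (2 * real m + \<nu>))"

text \<open>
  The McDonald function for real order and argument \<open>z > 0\<close>.  At integer orders the quotient
  is of the form \<open>0 / 0\<close>, and the function is defined by its limit in the order.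
\<close>

definition mcdonald_quotient :: "real \<Rightarrow> real \<Rightarrow> real" where
  "mcdonald_quotient \<nu> z = pi / 2 * ((bessel_I (- \<nu>) z - bessel_I \<nu> z) / sin (\<nu> * pi))"

definition mcdonald_K :: "real \<Rightarrow> real \<Rightarrow> real" where
  "mcdonald_K \<nu> z =
     (if \<nu> \<in> \<int> then Lim (at \<nu>) (\<lambda>\<alpha>. mcdonald_quotient \<alpha> z) else mcdonald_quotient \<nu> z)"

end

theory Submission
  imports Defs
begin

text \<open>
  Up to a constant, the density is the Laplace transform, at \<open>s = lam + \<mu>\<close>, of \<open>exp (lam * q) / q\<close> with
  \<open>q = sqrt (\<tau>\<^sup>2 - a\<^sup>2)\<close> and \<open>a = norm x / c\<close>.  Expanding the exponential in powers of \<open>q\<close> gives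
  nonnegative terms, so summation and integration commute, and each term is an integral of Basset's
  type, the Laplace transform of \<open>(\<tau>\<^sup>2 - a\<^sup>2) powr (\<nu> - 1 / 2)\<close> with \<open>\<nu> = k / 2\<close>, whose value is
  a Gamma value and a power of \<open>2 * a / s\<close> times the McDonald function of order \<open>\<nu>\<close> (\<open>nn_integral_Basset\<close>,
  \<open>sums_exp_sqrt_Laplace\<close>).

  The substance is Basset's formula, since the McDonald function is given by a difference of two
  power series and, at integer orders, by a limit of such differences.  The bridge between series and
  integrals is the function
  \<open>extended_Gamma a y\<close>, the integral of \<open>t powr (a - 1) * exp (- t - y / t)\<close> over \<open>t > 0\<close>.  At
  \<open>y = z\<^sup>2 / 4\<close> both it and the renormalised series form a family \<open>F a\<close> with

    \<^item> \<open>F a' = - F (a - 1)\<close>,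
    \<^item> \<open>F (- a) y = y powr (- a) * F a y\<close>,
    \<^item> \<open>F a y \<longlongrightarrow> Gamma a\<close> as \<open>y\<close> decreases to \<open>0\<close>, for \<open>0 < a < 1\<close>.

  For the series the last property is Euler's reflection formula.  For \<open>0 < a < 1\<close> the first two
  properties combine into a first-order linear system for \<open>F a\<close> and \<open>F (1 - a)\<close> with coefficients
  integrable at \<open>0\<close>, so the limits at \<open>0\<close> determine the family there
  (\<open>coupled_system_zero_at_0\<close>), and then at all noninteger orders
  (\<open>macdonald_series_eq_extended_Gamma\<close>).  The integral is convex, hence
  continuous, in \<open>a\<close>, which settles the integer orders (\<open>mcdonald_K_eq_extended_Gamma\<close>).

  The same properties at order \<open>1 / 2\<close> give the closed form \<open>sqrt pi * exp (- 2 * sqrt y)\<close>, that is,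
  a representation of \<open>exp (- s * \<tau>)\<close> as a mixture of Gaussians in \<open>\<tau>\<close>.  Inserting it into
  Basset's integral and exchanging the integrations leaves a Gamma integral inside and an
  \<open>extended_Gamma\<close> integral outside.
\<close>

section \<open>Change of variables for nonnegative functions\<close>

text \<open>
  The change of variables for absolutely integrable functions is an equivalence, so if one side is
  infinite then so is the other.
\<close>

lemma nn_integral_change_of_variables_real:
  fixes f g h :: "real \<Rightarrow> real"
  assumes meas [measurable]: "S \<in> sets borel" "g ` S \<in> sets borel"
      "f \<in> borel_measurable borel" "g \<in> borel_measurable borel" "h \<in> borel_measurable borel"
    and deriv: "\<And>s. s \<in> S \<Longrightarrow> (g has_real_derivative h s) (at s)"
    and inj: "inj_on g S"
    and nonneg: "\<And>t. t \<in> g ` S \<Longrightarrow> 0 \<le> f t"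
  shows "(\<integral>\<^sup>+t\<in>g ` S. ennreal (f t) \<partial>lborel) = (\<integral>\<^sup>+s\<in>S. ennreal (\<bar>h s\<bar> * f (g s)) \<partial>lborel)"
proof -
  let ?F = "\<lambda>t. indicator (g ` S) t * f t" and ?G = "\<lambda>s. indicator S s * (\<bar>h s\<bar> * f (g s))"
  have F0: "0 \<le> ?F t" and G0: "0 \<le> ?G t" for t
    using nonneg by (auto simp: indicator_def)
  have F: "(\<integral>\<^sup>+t\<in>g ` S. ennreal (f t) \<partial>lborel) = (\<integral>\<^sup>+t. ennreal (?F t) \<partial>lborel)"
    by (intro nn_integral_cong) (auto simp: indicator_def)
  have G: "(\<integral>\<^sup>+s\<in>S. ennreal (\<bar>h s\<bar> * f (g s)) \<partial>lborel) = (\<integral>\<^sup>+t. ennreal (?G t) \<partial>lborel)"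
    by (intro nn_integral_cong) (auto simp: indicator_def)
  have sub: "(\<lambda>x. \<bar>h x\<bar> * f (g x)) absolutely_integrable_on S \<and>
           integral S (\<lambda>x. \<bar>h x\<bar> * f (g x)) = b
     \<longleftrightarrow> f absolutely_integrable_on (g ` S) \<and> integral (g ` S) f = b" for b
    by (intro has_absolute_integral_change_of_variables_1' inj)
       (auto intro: has_field_derivative_at_within deriv)
  have aF: "f absolutely_integrable_on (g ` S) \<longleftrightarrow> integrable lborel ?F"
    unfolding set_integrable_def real_scaleR_def by (intro integrable_completion) simp
  have aG: "(\<lambda>x. \<bar>h x\<bar> * f (g x)) absolutely_integrable_on S \<longleftrightarrow> integrable lborel ?G"
    unfolding set_integrable_def real_scaleR_def by (intro integrable_completion) simp
  show ?thesis
  proof (cases "integrable lborel ?F")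
    case True
    with sub aF aG have iG: "integrable lborel ?G"
      and eq: "integral S (\<lambda>x. \<bar>h x\<bar> * f (g x)) = integral (g ` S) f"
      by blast+
    have "integral\<^sup>L lborel ?F = integral (g ` S) f"
      using set_borel_integral_eq_integral(2)[of "g ` S" f] True
      by (simp add: set_integrable_def set_lebesgue_integral_def)
    moreover have "integral\<^sup>L lborel ?G = integral S (\<lambda>x. \<bar>h x\<bar> * f (g x))"
      using set_borel_integral_eq_integral(2)[of S "\<lambda>x. \<bar>h x\<bar> * f (g x)"] iG
      by (simp add: set_integrable_def set_lebesgue_integral_def)
    ultimately show ?thesis
      unfolding F G using True iG F0 G0 eq by (simp add: nn_integral_eq_integral)
  next
    case False
    with sub aF aG have "\<not> integrable lborel ?G" by blast
    with False have "(\<integral>\<^sup>+t. ennreal (?F t) \<partial>lborel) = \<infinity>" "(\<integral>\<^sup>+t. ennreal (?G t) \<partial>lborel) = \<infinity>"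
      using F0 G0 by (auto intro!: integrableI_nonneg simp: less_top[symmetric])
    then show ?thesis unfolding F G by simp
  qed
qed

section \<open>The Bessel-Clifford series\<close>

text \<open>
  Splitting off the power \<open>(z / 2) powr \<nu>\<close> from \<open>bessel_I\<close> leaves an entire function of
  \<open>y = z\<^sup>2 / 4\<close>, so that all differentiation is of power series.
\<close>

definition bessel_clifford :: "real \<Rightarrow> real \<Rightarrow> real" where
  "bessel_clifford \<nu> y = (\<Sum>m. rGamma (real m + \<nu> + 1) / fact m * y ^ m)"

lemma summable_bessel_clifford:
  "summable (\<lambda>m. rGamma (real m + \<nu> + 1) / fact m * y ^ m)"
proof (rule summable_ratio_test)
  let ?f = "\<lambda>m. rGamma (real m + \<nu> + 1) / fact m * y ^ m"
  show "(1 / 2 :: real) < 1" by simp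
  fix n :: nat
  assume "n \<ge> nat \<lceil>\<bar>\<nu>\<bar> + 2 * \<bar>y\<bar>\<rceil>"
  then have n: "\<bar>\<nu>\<bar> + 2 * \<bar>y\<bar> \<le> real n" by linarith
  then have pos: "real n + \<nu> + 1 \<ge> 1" by linarith
  have y: "2 * \<bar>y\<bar> \<le> real n + 1" using n by linarith
  have r: "rGamma (real n + \<nu> + 1) = (real n + \<nu> + 1) * rGamma (real (Suc n) + \<nu> + 1)"
    using rGamma_plus1[of "real n + \<nu> + 1"] by (simp add: algebra_simps)
  have "norm (?f (Suc n)) = \<bar>rGamma (real (Suc n) + \<nu> + 1)\<bar> / fact n * \<bar>y\<bar> ^ n * (\<bar>y\<bar> / (real n + 1))"
    by (simp add: abs_mult power_abs field_simps)
  also have "\<dots> \<le> \<bar>rGamma (real (Suc n) + \<nu> + 1)\<bar> / fact n * \<bar>y\<bar> ^ n * (1 / 2)"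
    using y by (intro mult_left_mono) (simp_all add: field_simps)
  also have "\<dots> \<le> 1 / 2 * (\<bar>(real n + \<nu> + 1) * rGamma (real (Suc n) + \<nu> + 1)\<bar> / fact n * \<bar>y\<bar> ^ n)"
  proof -
    have "\<bar>rGamma (real (Suc n) + \<nu> + 1)\<bar> \<le> \<bar>(real n + \<nu> + 1) * rGamma (real (Suc n) + \<nu> + 1)\<bar>"
      using pos mult_right_mono[of 1 "\<bar>real n + \<nu> + 1\<bar>" "\<bar>rGamma (real (Suc n) + \<nu> + 1)\<bar>"]
      by (simp add: abs_mult)
    then have "\<bar>rGamma (real (Suc n) + \<nu> + 1)\<bar> / fact n * \<bar>y\<bar> ^ n
        \<le> \<bar>(real n + \<nu> + 1) * rGamma (real (Suc n) + \<nu> + 1)\<bar> / fact n * \<bar>y\<bar> ^ n"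
      by (intro mult_right_mono divide_right_mono) simp_all
    from mult_left_mono[OF this, of "1 / 2"] show ?thesis by (simp only: mult_ac)
  qed
  also have "\<dots> = 1 / 2 * norm (?f n)"
    using r by (simp add: abs_mult power_abs)
  finally show "norm (?f (Suc n)) \<le> 1 / 2 * norm (?f n)" .
qed

lemma bessel_clifford_0: "bessel_clifford \<nu> 0 = rGamma (\<nu> + 1)"
  using powser_zero[of "\<lambda>m. rGamma (real m + \<nu> + 1) / fact m"] by (simp add: bessel_clifford_def)

lemma DERIV_bessel_clifford:
  "(bessel_clifford \<nu> has_real_derivative bessel_clifford (\<nu> + 1) y) (at y)"
proof -
  have "diffs (\<lambda>m. rGamma (real m + \<nu> + 1) / fact m)
      = (\<lambda>m. rGamma (real m + (\<nu> + 1) + 1) / fact m)"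
    by (auto simp: diffs_def fun_eq_iff divide_simps add_ac)
  with termdiffs_strong_converges_everywhere[OF summable_bessel_clifford[of \<nu>], of y]
  show ?thesis by (simp add: bessel_clifford_def[abs_def])
qed

lemma bessel_clifford_recurrence:
  "\<nu> * bessel_clifford \<nu> y + y * bessel_clifford (\<nu> + 1) y = bessel_clifford (\<nu> - 1) y"
proof -
  let ?c = "\<lambda>\<nu> m. rGamma (real m + \<nu> + 1) / fact m * y ^ m"
  let ?d = "\<lambda>m. real m * ?c \<nu> m"
  have "(\<lambda>m. y * ?c (\<nu> + 1) m) sums (y * bessel_clifford (\<nu> + 1) y)"
    unfolding bessel_clifford_def by (intro sums_mult summable_sums summable_bessel_clifford)
  moreover have "(\<lambda>m. y * ?c (\<nu> + 1) m) = (\<lambda>m. ?d (Suc m))"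
    by (auto simp: fun_eq_iff divide_simps add_ac)
  ultimately have "?d sums (y * bessel_clifford (\<nu> + 1) y)"
    using sums_Suc[of ?d] by simp
  moreover have "(\<lambda>m. \<nu> * ?c \<nu> m) sums (\<nu> * bessel_clifford \<nu> y)"
    unfolding bessel_clifford_def by (intro sums_mult summable_sums summable_bessel_clifford)
  ultimately have "(\<lambda>m. \<nu> * ?c \<nu> m + ?d m) sums
      (\<nu> * bessel_clifford \<nu> y + y * bessel_clifford (\<nu> + 1) y)"
    by (intro sums_add)
  moreover have "(\<lambda>m. \<nu> * ?c \<nu> m + ?d m) = ?c (\<nu> - 1)"
  proof
    fix m
    have "\<nu> * ?c \<nu> m + ?d m = (real m + \<nu>) * rGamma (real m + \<nu> + 1) / fact m * y ^ m"
      by (simp add: field_simps)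
    then show "\<nu> * ?c \<nu> m + ?d m = ?c (\<nu> - 1) m"
      by (simp add: rGamma_plus1)
  qed
  ultimately show ?thesis
    by (simp add: bessel_clifford_def sums_iff)
qed

lemma bessel_I_eq_bessel_clifford:
  assumes "z > 0"
  shows "bessel_I \<nu> z = (z / 2) powr \<nu> * bessel_clifford \<nu> (z\<^sup>2 / 4)"
proof -
  have "rGamma (real m + \<nu> + 1) / fact m * (z / 2) powr (2 * real m + \<nu>) =
      (z / 2) powr \<nu> * (rGamma (real m + \<nu> + 1) / fact m * (z\<^sup>2 / 4) ^ m)" for m
  proof -
    have "(z / 2) powr (2 * real m) = (z\<^sup>2 / 4) ^ m"
      using assms powr_realpow[of "z / 2" "2 * m"]
      by (simp add: power_mult power_divide)
    then show ?thesis by (simp add: powr_add)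
  qed
  then show ?thesis
    using suminf_mult[OF summable_bessel_clifford[of \<nu> "z\<^sup>2 / 4"], of "(z / 2) powr \<nu>"]
    unfolding bessel_I_def bessel_clifford_def by presburger
qed

section \<open>The extended Gamma function\<close>

text \<open>
  The extended Gamma function of Chaudhry and Zubair.  Up to a factor \<open>2\<close> and a power of
  \<open>z\<close> it is the McDonald function at \<open>y = z\<^sup>2 / 4\<close>.  It is used instead of the more common integral of
  \<open>exp (- z * cosh t) * cosh (a * t)\<close> because its reflection formula, its derivative and its limit
  at \<open>y = 0\<close> come without integration by parts.
\<close>

definition extended_Gamma :: "real \<Rightarrow> real \<Rightarrow> real" where
  "extended_Gamma a y = (LBINT t:{0<..}. t powr (a - 1) * exp (- t - y / t))"

lemma
  fixes a :: real
  assumes "a > 0"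
  shows set_integrable_Gamma: "set_integrable lborel {0<..} (\<lambda>t. t powr (a - 1) * exp (- t))"
    and set_integral_Gamma: "(LBINT t:{0<..}. t powr (a - 1) * exp (- t)) = Gamma a"
proof -
  have eq: "ennreal (indicator {0..} t * t powr (a - 1) / exp t)
      = ennreal (indicator {0<..} t *\<^sub>R (t powr (a - 1) * exp (- t)))" for t :: real
    by (auto simp: indicator_def exp_minus field_simps)
  have nn: "(\<integral>\<^sup>+t. ennreal (indicator {0<..} t *\<^sub>R (t powr (a - 1) * exp (- t))) \<partial>lborel) = ennreal (Gamma a)"
    using Gamma_conv_nn_integral_real[OF assms] unfolding eq by simp
  show int: "set_integrable lborel {0<..} (\<lambda>t. t powr (a - 1) * exp (- t))"
    unfolding set_integrable_def
    by (rule integrableI_nonneg) (use nn in simp_all)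
  show "(LBINT t:{0<..}. t powr (a - 1) * exp (- t)) = Gamma a"
    unfolding set_lebesgue_integral_def
    by (subst integral_eq_nn_integral) (use nn Gamma_real_pos[OF assms] in simp_all)
qed

text \<open>
  For \<open>a \<le> 0\<close> the power is not integrable at \<open>0\<close>; there one term of the exponential series,
  \<open>exp (y / t) \<ge> (y / t) ^ n / fact n\<close>, buys \<open>n\<close> powers of \<open>t\<close> and reduces the bound to
  an ordinary Gamma integral.
\<close>

lemma set_integrable_extended_Gamma:
  fixes a y :: real
  assumes "y > 0"
  shows "set_integrable lborel {0<..} (\<lambda>t. t powr (a - 1) * exp (- t - y / t))"
proof -
  define n where "n = nat \<lceil>1 - a\<rceil>"
  have pos: "a + real n > 0" unfolding n_def by linarith
  have "set_integrable lborel {0<..} (\<lambda>t. (fact n / y ^ n) * (t powr (a + real n - 1) * exp (- t)))"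
    by (intro set_integrable_mult_right set_integrable_Gamma pos)
  then show ?thesis
  proof (rule set_integrable_bound)
    show "AE t in lborel. t \<in> {0<..} \<longrightarrow> norm (t powr (a - 1) * exp (- t - y / t))
        \<le> norm (fact n / y ^ n * (t powr (a + real n - 1) * exp (- t)))"
    proof (rule AE_I2, rule impI)
      fix t :: real assume "t \<in> {0<..}"
      then have t: "t > 0" by simp
      have "(y / t) ^ n / fact n \<le> exp (y / t)"
        using sum_le_suminf[OF summable_exp_generic[of "y / t"], of "{n}"] assms t
        by (simp add: exp_def divide_inverse_commute)
      then have "exp (- (y / t)) \<le> fact n * (t / y) ^ n"
        using assms t by (simp add: exp_minus field_simps)
      then have "t powr (a - 1) * exp (- t) * exp (- (y / t))
          \<le> t powr (a - 1) * exp (- t) * (fact n * (t / y) ^ n)"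
        by (intro mult_left_mono) simp_all
      also have "\<dots> = fact n / y ^ n * ((t powr (a - 1) * t powr real n) * exp (- t))"
        using t by (simp add: powr_realpow power_divide)
      finally have "t powr (a - 1) * (exp (- t) * exp (- (y / t)))
          \<le> fact n / y ^ n * ((t powr (a - 1) * t powr real n) * exp (- t))"
        by (simp only: mult.assoc)
      moreover have e: "exp (- t - y / t) = exp (- t) * exp (- (y / t))"
        by (simp flip: exp_add)
      moreover have p: "t powr (a + real n - 1) = t powr (a - 1) * t powr real n"
        by (simp add: algebra_simps flip: powr_add)
      ultimately show "norm (t powr (a - 1) * exp (- t - y / t))
          \<le> norm (fact n / y ^ n * (t powr (a + real n - 1) * exp (- t)))"
        using assms t by (simp add: abs_mult e p)
    qed
  qed (simp add: set_borel_measurable_def)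
qed

lemma nn_integral_extended_Gamma:
  fixes a y :: real
  assumes "y > 0"
  shows "(\<integral>\<^sup>+t\<in>{0<..}. ennreal (t powr (a - 1) * exp (- t - y / t)) \<partial>lborel) = ennreal (extended_Gamma a y)"
proof -
  have "(\<integral>\<^sup>+t\<in>{0<..}. ennreal (t powr (a - 1) * exp (- t - y / t)) \<partial>lborel)
      = (\<integral>\<^sup>+t. ennreal (indicator {0<..} t *\<^sub>R (t powr (a - 1) * exp (- t - y / t))) \<partial>lborel)"
    by (intro nn_integral_cong) (auto simp: indicator_def)
  then show ?thesis
    using set_integrable_extended_Gamma[OF assms, of a]
    unfolding extended_Gamma_def set_lebesgue_integral_def set_integrable_def
    by (simp add: nn_integral_eq_integral)
qed

lemma extended_Gamma_nonneg: "extended_Gamma a y \<ge> 0"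
  unfolding extended_Gamma_def set_lebesgue_integral_def
  by (intro integral_nonneg_AE) simp

text \<open>
  The substitution \<open>t \<mapsto> y / t\<close> exchanges the two terms of the exponent.
\<close>

lemma extended_Gamma_reflect:
  assumes "y > 0"
  shows "extended_Gamma (- a) y = y powr (- a) * extended_Gamma a y"
proof -
  let ?g = "\<lambda>t. y / t"
  have img: "?g ` {0<..} = {0<..}"
    using assms by (auto simp: image_iff intro!: bexI[of _ "y / _"])
  have "ennreal (extended_Gamma (- a) y)
      = (\<integral>\<^sup>+t\<in>?g ` {0<..}. ennreal (t powr (- a - 1) * exp (- t - y / t)) \<partial>lborel)"
    using assms by (simp only: img nn_integral_extended_Gamma)
  also have "\<dots> = (\<integral>\<^sup>+t\<in>{0<..}. ennreal (\<bar>- y / t\<^sup>2\<bar> * (?g t powr (- a - 1) * exp (- ?g t - y / ?g t))) \<partial>lborel)"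
  proof (rule nn_integral_change_of_variables_real)
    show "?g ` {0<..} \<in> sets borel" by (simp add: img)
    show "inj_on ?g {0<..}" using assms by (auto simp: inj_on_def)
    show "(?g has_real_derivative - y / s\<^sup>2) (at s)" if "s \<in> {0<..}" for s
      using that by (auto intro!: derivative_eq_intros simp: power2_eq_square)
  qed simp_all
  also have "\<dots> = (\<integral>\<^sup>+t. ennreal (y powr (- a)) *
      (ennreal (t powr (a - 1) * exp (- t - y / t)) * indicator {0<..} t) \<partial>lborel)"
  proof (intro nn_integral_cong)
    fix t :: real
    have "\<bar>- y / t\<^sup>2\<bar> * (?g t powr (- a - 1) * exp (- ?g t - y / ?g t))
        = y powr (- a) * (t powr (a - 1) * exp (- t - y / t))" if "t > 0"
    proof -
      have "?g t powr (- a - 1) = y powr (- a) * t powr (a - 1) * (t\<^sup>2 / y)"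
        using assms that
        by (simp add: powr_divide powr_diff powr_minus power2_eq_square field_simps)
      moreover have "- ?g t - y / ?g t = - t - y / t"
        using assms that by simp
      ultimately show ?thesis using assms that by (simp add: power2_eq_square)
    qed
    then show "ennreal (\<bar>- y / t\<^sup>2\<bar> * (?g t powr (- a - 1) * exp (- ?g t - y / ?g t))) * indicator {0<..} t
        = ennreal (y powr (- a)) * (ennreal (t powr (a - 1) * exp (- t - y / t)) * indicator {0<..} t)"
      by (auto simp: indicator_def simp flip: ennreal_mult')
  qed
  also have "\<dots> = ennreal (y powr (- a) * extended_Gamma a y)"
    using assms by (subst nn_integral_cmult)
      (simp_all add: nn_integral_extended_Gamma flip: ennreal_mult')
  finally show ?thesis by (simp add: extended_Gamma_nonneg)
qed

text \<open>
  For fixed \<open>t\<close> the integrand is an exponential function of \<open>a\<close>, hence convex.  The only purpose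
  is continuity in the order, which the McDonald function of integer order requires.
\<close>

lemma convex_on_extended_Gamma:
  assumes "y > 0"
  shows "convex_on UNIV (\<lambda>a. extended_Gamma a y)"
proof (rule convex_onI)
  fix u a b :: real
  assume u: "0 < u" "u < 1"
  let ?f = "\<lambda>a t. t powr (a - 1) * exp (- t - y / t)"
  have conv: "?f ((1 - u) * a + u * b) t \<le> (1 - u) * ?f a t + u * ?f b t" if "t > 0" for t
  proof -
    have "exp ((1 - u) * ((a - 1) * ln t) + u * ((b - 1) * ln t))
        \<le> (1 - u) * exp ((a - 1) * ln t) + u * exp ((b - 1) * ln t)"
      using convex_onD[OF exp_convex, of u "(a - 1) * ln t" "(b - 1) * ln t"] u by simp
    moreover have "(1 - u) * ((a - 1) * ln t) + u * ((b - 1) * ln t) = ((1 - u) * a + u * b - 1) * ln t"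
      by (simp add: algebra_simps)
    ultimately have "t powr ((1 - u) * a + u * b - 1) \<le> (1 - u) * t powr (a - 1) + u * t powr (b - 1)"
      using that by (simp add: powr_def)
    from mult_right_mono[OF this, of "exp (- t - y / t)"] show ?thesis
      by (simp add: algebra_simps)
  qed
  have "extended_Gamma ((1 - u) * a + u * b) y \<le> (LBINT t:{0<..}. (1 - u) * ?f a t + u * ?f b t)"
    unfolding extended_Gamma_def
    by (intro set_integral_mono set_integral_add(1) set_integrable_mult_right
        set_integrable_extended_Gamma assms conv) auto
  also have "\<dots> = (1 - u) * extended_Gamma a y + u * extended_Gamma b y"
    unfolding extended_Gamma_def
    by (subst set_integral_add(2))
       (auto intro!: set_integrable_mult_right set_integrable_extended_Gamma assms)
  finally show "extended_Gamma ((1 - u) *\<^sub>R a + u *\<^sub>R b) y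
      \<le> (1 - u) * extended_Gamma a y + u * extended_Gamma b y" by simp
qed simp

lemma isCont_extended_Gamma_order:
  assumes "y > 0"
  shows "isCont (\<lambda>a. extended_Gamma a y) a"
  using convex_on_continuous[OF open_UNIV convex_on_extended_Gamma[OF assms]]
  by (simp add: continuous_on_eq_continuous_at)

text \<open>
  Differentiation under the integral sign.  For arguments above \<open>y / 2\<close> the mean value theorem
  bounds all difference quotients by the integrand at order \<open>a - 1\<close> and argument \<open>y / 2\<close>.
\<close>

lemma DERIV_extended_Gamma:
  assumes "y > 0"
  shows "(extended_Gamma a has_real_derivative - extended_Gamma (a - 1) y) (at y)"
proof -
  let ?f = "\<lambda>a y t. t powr (a - 1) * exp (- t - y / t)"
  let ?S = "{y / 2<..}"
  have "((\<lambda>x. (extended_Gamma a x - extended_Gamma a y) / (x - y))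
      \<longlongrightarrow> - extended_Gamma (a - 1) y) (at y within ?S)"
    unfolding tendsto_at_iff_sequentially
  proof (intro allI impI)
    fix X :: "nat \<Rightarrow> real"
    assume X: "\<forall>i. X i \<in> ?S - {y}" "X \<longlonglongrightarrow> y"
    then have Xpos: "X i > y / 2" "X i \<noteq> y" "X i > 0" for i using assms by (auto intro: less_trans[of 0 "y / 2"])
    let ?q = "\<lambda>i t. indicator {0<..} t * ((?f a (X i) t - ?f a y t) / (X i - y))"
    have "(\<lambda>i. integral\<^sup>L lborel (?q i)) \<longlonglongrightarrow>
        integral\<^sup>L lborel (\<lambda>t. indicator {0<..} t * - ?f (a - 1) y t)"
    proof (rule integral_dominated_convergence[where w = "\<lambda>t. indicator {0<..} t * ?f (a - 1) (y / 2) t"])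
      show "integrable lborel (\<lambda>t. indicator {0<..} t * ?f (a - 1) (y / 2) t)"
        using set_integrable_extended_Gamma[of "y / 2" "a - 1"] assms by (simp add: set_integrable_def)
      show "AE t in lborel. (\<lambda>i. ?q i t) \<longlonglongrightarrow> indicator {0<..} t * - ?f (a - 1) y t"
      proof (rule AE_I2)
        fix t :: real
        show "(\<lambda>i. ?q i t) \<longlonglongrightarrow> indicator {0<..} t * - ?f (a - 1) y t"
        proof (cases "t > 0")
          case True
          have "((\<lambda>x. ?f a x t) has_real_derivative - ?f (a - 1) y t) (at y)"
            using True by (auto intro!: derivative_eq_intros simp: powr_diff powr_mult_base field_simps power2_eq_square)
          then have "((\<lambda>x. (?f a x t - ?f a y t) / (x - y)) \<longlongrightarrow> - ?f (a - 1) y t) (at y)"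
            by (simp add: has_field_derivative_iff)
          then have "(\<lambda>i. (?f a (X i) t - ?f a y t) / (X i - y)) \<longlonglongrightarrow> - ?f (a - 1) y t"
            using X unfolding tendsto_at_iff_sequentially comp_def by auto
          with True show ?thesis by simp
        qed simp
      qed
      show "AE t in lborel. norm (?q i t) \<le> indicator {0<..} t * ?f (a - 1) (y / 2) t" for i
      proof (rule AE_I2)
        fix t :: real
        show "norm (?q i t) \<le> indicator {0<..} t * ?f (a - 1) (y / 2) t"
        proof (cases "t > 0")
          case True
          have "norm (?f a (X i) t - ?f a y t) \<le> ?f (a - 1) (y / 2) t * norm (X i - y)"
          proof (rule field_differentiable_bound[where S = "{y / 2..}"])
            fix x assume x: "x \<in> {y / 2..}"
            show "((\<lambda>x. ?f a x t) has_real_derivative - ?f (a - 1) x t) (at x within {y / 2..})"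
              using True by (auto intro!: derivative_eq_intros simp: powr_diff powr_mult_base field_simps power2_eq_square)
            show "norm (- ?f (a - 1) x t) \<le> ?f (a - 1) (y / 2) t"
              using True x divide_right_mono[of "y / 2" x t] by (simp add: abs_mult mult_left_mono)
          qed (use assms Xpos[of i] in auto)
          with True Xpos[of i] show ?thesis by (simp add: field_simps)
        qed simp
      qed
    qed simp_all
    moreover have "integral\<^sup>L lborel (?q i) = (extended_Gamma a (X i) - extended_Gamma a y) / (X i - y)" for i
      using set_integral_diff(2)[OF set_integrable_extended_Gamma[OF Xpos(3)[of i], of a] set_integrable_extended_Gamma[OF assms, of a]]
      unfolding times_divide_eq_right integral_divide_zero
      by (simp add: extended_Gamma_def set_lebesgue_integral_def)
    moreover have "integral\<^sup>L lborel (\<lambda>t. indicator {0<..} t * - ?f (a - 1) y t) = - extended_Gamma (a - 1) y"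
      by (simp add: extended_Gamma_def set_lebesgue_integral_def)
    ultimately show "((\<lambda>x. (extended_Gamma a x - extended_Gamma a y) / (x - y)) \<circ> X)
        \<longlonglongrightarrow> - extended_Gamma (a - 1) y"
      by (simp only: comp_def)
  qed
  then show ?thesis
    using assms by (simp add: has_field_derivative_iff at_within_open[of y "{y / 2<..}"])
qed

lemma tendsto_extended_Gamma_0:
  assumes "a > 0"
  shows "(extended_Gamma a \<longlongrightarrow> Gamma a) (at_right 0)"
  unfolding tendsto_at_iff_sequentially
proof (intro allI impI)
  fix X :: "nat \<Rightarrow> real"
  assume X: "\<forall>i. X i \<in> {0<..} - {0}" "X \<longlonglongrightarrow> 0"
  have "(\<lambda>i. LBINT t:{0<..}. t powr (a - 1) * exp (- t - X i / t))
      \<longlonglongrightarrow> (LBINT t:{0<..}. t powr (a - 1) * exp (- t))"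
    unfolding set_lebesgue_integral_def
  proof (rule integral_dominated_convergence[where w = "\<lambda>t. indicator {0<..} t *\<^sub>R (t powr (a - 1) * exp (- t))"])
    show "integrable lborel (\<lambda>t. indicator {0<..} t *\<^sub>R (t powr (a - 1) * exp (- t)))"
      using set_integrable_Gamma[OF assms] by (simp add: set_integrable_def)
    show "AE t in lborel. (\<lambda>i. indicator {0<..} t *\<^sub>R (t powr (a - 1) * exp (- t - X i / t)))
        \<longlonglongrightarrow> indicator {0<..} t *\<^sub>R (t powr (a - 1) * exp (- t))"
    proof (rule AE_I2)
      fix t :: real
      have "(\<lambda>i. exp (- t - X i / t)) \<longlonglongrightarrow> exp (- t - 0 / t)" if "t > 0"
        using that X by (intro tendsto_intros) auto
      then show "(\<lambda>i. indicator {0<..} t *\<^sub>R (t powr (a - 1) * exp (- t - X i / t)))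
          \<longlonglongrightarrow> indicator {0<..} t *\<^sub>R (t powr (a - 1) * exp (- t))"
        by (cases "t > 0") (auto intro!: tendsto_intros)
    qed
    show "AE t in lborel. norm (indicator {0<..} t *\<^sub>R (t powr (a - 1) * exp (- t - X i / t)))
        \<le> indicator {0<..} t *\<^sub>R (t powr (a - 1) * exp (- t))" for i
      using X(1) by (intro AE_I2) (auto simp: indicator_def abs_mult less_imp_le intro!: mult_left_mono)
  qed simp_all
  then show "(extended_Gamma a \<circ> X) \<longlonglongrightarrow> Gamma a"
    using set_integral_Gamma[OF assms] by (simp add: comp_def extended_Gamma_def)
qed

text \<open>
  At order \<open>1 / 2\<close> differentiation leads to order \<open>- 1 / 2\<close> and reflection leads back, which
  gives the equation \<open>f' = - f / sqrt y\<close> with \<open>f 0 = Gamma (1 / 2)\<close>.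
\<close>

lemma extended_Gamma_half:
  assumes "y > 0"
  shows "extended_Gamma (1 / 2) y = sqrt pi * exp (- 2 * sqrt y)"
proof -
  let ?F = "\<lambda>y. extended_Gamma (1 / 2) y * exp (2 * sqrt y)"
  have deriv: "(?F has_real_derivative 0) (at x)" if "x > 0" for x
  proof -
    have "extended_Gamma (1 / 2 - 1) x = extended_Gamma (1 / 2) x / sqrt x"
      using extended_Gamma_reflect[OF that, of "1 / 2"] that
      by (simp add: powr_minus powr_half_sqrt field_simps)
    then show ?thesis
      using that by (auto intro!: derivative_eq_intros DERIV_extended_Gamma simp: field_simps)
  qed
  have const: "?F x = ?F y" if "x > 0" for x
    using has_field_derivative_zero_constant[of "{0<..}" ?F] assms that
    by (metis (no_types, lifting) convex_real_interval(3) deriv greaterThan_iff has_field_derivative_at_within)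
  have "(?F \<longlongrightarrow> Gamma (1 / 2) * exp (2 * sqrt 0)) (at_right 0)"
    by (intro tendsto_intros tendsto_extended_Gamma_0) auto
  moreover have "eventually (\<lambda>x. ?F x = ?F y) (at_right 0)"
    using const by (auto simp: eventually_at_right_field intro: exI[of _ 1])
  ultimately have "((\<lambda>_. ?F y) \<longlongrightarrow> sqrt pi) (at_right (0::real))"
    by (simp add: Gamma_one_half_real filterlim_cong)
  then have "?F y = sqrt pi"
    by (simp add: tendsto_const_iff)
  then show ?thesis
    by (simp add: exp_minus field_simps)
qed

section \<open>The McDonald function as an extended Gamma function\<close>

text \<open>
  The quotient that defines the McDonald function, multiplied by \<open>2 * (z / 2) powr a\<close> and written
  in \<open>y = z\<^sup>2 / 4\<close>.  This is the series that \<open>extended_Gamma a y\<close> is to be matched with: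
  the next lemmas give it the same reflection formula, derivative and limit at \<open>0\<close>.
\<close>

definition macdonald_series :: "real \<Rightarrow> real \<Rightarrow> real" where
  "macdonald_series a y =
     pi / sin (a * pi) * (bessel_clifford (- a) y - y powr a * bessel_clifford a y)"

lemma mcdonald_quotient_eq:
  assumes "z > 0"
  shows "mcdonald_quotient \<nu> z = 1 / 2 * (z / 2) powr (- \<nu>) * macdonald_series \<nu> (z\<^sup>2 / 4)"
proof -
  have "(z\<^sup>2 / 4) powr \<nu> = (z / 2) powr \<nu> * (z / 2) powr \<nu>"
    using assms by (simp add: power2_eq_square flip: powr_mult)
  moreover have "(z / 2) powr (- \<nu>) * (z / 2) powr \<nu> = 1"
    using assms by (simp flip: powr_add)
  ultimately have *: "(z / 2) powr (- \<nu>) * ((z\<^sup>2 / 4) powr \<nu> * bessel_clifford \<nu> (z\<^sup>2 / 4))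
      = (z / 2) powr \<nu> * bessel_clifford \<nu> (z\<^sup>2 / 4)"
    by (simp add: mult.assoc[symmetric])
  have "1 / 2 * (z / 2) powr (- \<nu>) * macdonald_series \<nu> (z\<^sup>2 / 4) =
      pi / 2 / sin (\<nu> * pi) * ((z / 2) powr (- \<nu>) * bessel_clifford (- \<nu>) (z\<^sup>2 / 4)
        - (z / 2) powr (- \<nu>) * ((z\<^sup>2 / 4) powr \<nu> * bessel_clifford \<nu> (z\<^sup>2 / 4)))"
    by (simp add: macdonald_series_def algebra_simps)
  then show ?thesis
    unfolding * mcdonald_quotient_def bessel_I_eq_bessel_clifford[OF assms] by simp
qed

lemma macdonald_series_reflect:
  assumes "y > 0"
  shows "macdonald_series (- a) y = y powr (- a) * macdonald_series a y"
proof -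
  let ?C = bessel_clifford
  have "y powr (- a) * y powr a = 1" using assms by (simp flip: powr_add)
  then have "y powr (- a) * (?C (- a) y - y powr a * ?C a y) = y powr (- a) * ?C (- a) y - ?C a y"
    by (simp add: right_diff_distrib flip: mult.assoc)
  then have "y powr (- a) * macdonald_series a y = pi / sin (a * pi) * (y powr (- a) * ?C (- a) y - ?C a y)"
    unfolding macdonald_series_def by (metis mult.left_commute)
  also have "\<dots> = macdonald_series (- a) y"
    by (simp add: macdonald_series_def right_diff_distrib)
  finally show ?thesis ..
qed

lemma DERIV_macdonald_series:
  assumes "y > 0"
  shows "(macdonald_series a has_real_derivative - macdonald_series (a - 1) y) (at y)"
proof -
  have "((\<lambda>y. y powr a * bessel_clifford a y) has_real_derivative
      y powr (a - 1) * bessel_clifford (a - 1) y) (at y)"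
  proof -
    have "((\<lambda>y. y powr a * bessel_clifford a y) has_real_derivative
        y powr (a - 1) * (a * bessel_clifford a y + y * bessel_clifford (a + 1) y)) (at y)"
      using assms by (auto intro!: derivative_eq_intros DERIV_bessel_clifford simp: powr_diff field_simps)
    then show ?thesis by (simp only: bessel_clifford_recurrence)
  qed
  moreover have "(bessel_clifford (- a) has_real_derivative bessel_clifford (- (a - 1)) y) (at y)"
    using DERIV_bessel_clifford[of "- a" y] by simp
  ultimately have "(macdonald_series a has_real_derivative
      pi / sin (a * pi) * (bessel_clifford (- (a - 1)) y - y powr (a - 1) * bessel_clifford (a - 1) y)) (at y)"
    unfolding macdonald_series_def[abs_def] by (intro DERIV_cmult DERIV_diff)
  moreover have "sin ((a - 1) * pi) = - sin (a * pi)"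
    by (simp add: left_diff_distrib sin_diff)
  ultimately show ?thesis by (simp add: macdonald_series_def)
qed

lemma Gamma_reflection_real:
  fixes a :: real
  shows "Gamma a * Gamma (1 - a) = pi / sin (a * pi)"
proof -
  have "complex_of_real (Gamma a * Gamma (1 - a)) = of_real (pi / sin (a * pi))"
    using Gamma_reflection_complex[of "of_real a"] Gamma_complex_of_real[of "1 - a"]
    by (simp add: Gamma_complex_of_real mult.commute flip: sin_of_real)
  then show ?thesis by (simp only: of_real_eq_iff)
qed

text \<open>
  Only \<open>bessel_clifford (- a) 0 = rGamma (1 - a)\<close> survives in the limit, and Euler's reflection
  formula turns its coefficient \<open>pi / sin (a * pi)\<close> into \<open>Gamma a\<close>.
\<close>

lemma tendsto_macdonald_series_0:
  assumes "0 < a" "a < 1"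
  shows "(macdonald_series a \<longlongrightarrow> Gamma a) (at_right 0)"
proof -
  have c: "(bessel_clifford b \<longlongrightarrow> rGamma (b + 1)) (at_right 0)" for b
    using DERIV_isCont[OF DERIV_bessel_clifford[of b 0]]
    by (simp add: isCont_def bessel_clifford_0 tendsto_within_subset filterlim_at_split)
  have "((\<lambda>y. y powr a) \<longlongrightarrow> 0) (at_right 0)"
    using assms by (intro tendsto_zero_powrI[where b = a]) (auto simp: eventually_at_right_field)
  from tendsto_mult[OF this c[of a]]
  have "(macdonald_series a \<longlongrightarrow> pi / sin (a * pi) * (rGamma (- a + 1) - 0)) (at_right 0)"
    unfolding macdonald_series_def[abs_def] using c[of "- a"] by (intro tendsto_intros) simp_all
  moreover have "pi / sin (a * pi) * rGamma (- a + 1) = Gamma a"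
  proof -
    have "Gamma (1 - a) > 0" using assms by simp
    then have "Gamma a = pi / sin (a * pi) / Gamma (1 - a)"
      by (simp flip: Gamma_reflection_real)
    then show ?thesis by (simp add: rGamma_inverse_Gamma divide_inverse)
  qed
  ultimately show ?thesis by simp
qed

text \<open>
  The coefficients \<open>y powr (b - 1)\<close> and \<open>y powr (- b)\<close> are singular at \<open>0\<close>, but
  integrable there because \<open>0 < b < 1\<close>, so Gronwall's argument works up to the singular point:
  with \<open>H\<close> a primitive of the sum of the coefficients, \<open>(U\<^sup>2 + V\<^sup>2) * exp (- H)\<close> is
  nonincreasing, nonnegative and tends to \<open>0\<close> at \<open>0\<close>.
\<close>

lemma coupled_system_zero_at_0:
  fixes U V :: "real \<Rightarrow> real"
  assumes U': "\<And>y. y > 0 \<Longrightarrow> (U has_real_derivative - (y powr (b - 1) * V y)) (at y)"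
    and V': "\<And>y. y > 0 \<Longrightarrow> (V has_real_derivative - (y powr (- b) * U y)) (at y)"
    and lim: "(U \<longlongrightarrow> 0) (at_right 0)" "(V \<longlongrightarrow> 0) (at_right 0)"
    and b: "0 < b" "b < 1" and y: "y > 0"
  shows "U y = 0"
proof -
  define H where "H y = y powr b / b + y powr (1 - b) / (1 - b)" for y :: real
  define E where "E y = ((U y)\<^sup>2 + (V y)\<^sup>2) * exp (- H y)" for y
  have E0: "(E \<longlongrightarrow> 0) (at_right 0)"
  proof -
    have "((\<lambda>y. y powr b) \<longlongrightarrow> 0) (at_right 0)" "((\<lambda>y. y powr (1 - b)) \<longlongrightarrow> 0) (at_right 0)"
      using b by (intro tendsto_zero_powrI[where b = b] tendsto_zero_powrI[where b = "1 - b"];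
        auto simp: eventually_at_right_field)+
    then have "(E \<longlongrightarrow> (0\<^sup>2 + 0\<^sup>2) * exp (- (0 / b + 0 / (1 - b)))) (at_right 0)"
      unfolding E_def H_def using b lim by (intro tendsto_intros) auto
    then show ?thesis by simp
  qed
  have "E y \<le> E x" if x: "0 < x" "x \<le> y" for x
  proof (rule DERIV_nonpos_imp_nonincreasing[OF x(2)])
    fix s assume "x \<le> s" "s \<le> y"
    with x have s: "s > 0" by simp
    let ?u = "U s" and ?v = "V s" and ?h = "s powr (b - 1)" and ?k = "s powr (- b)"
    have H': "(H has_real_derivative ?h + ?k) (at s)"
      unfolding H_def using s b by (auto intro!: derivative_eq_intros)
    have "(E has_real_derivative
        (2 * ?u * - (?h * ?v) + 2 * ?v * - (?k * ?u)) * exp (- H s)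
        + (?u\<^sup>2 + ?v\<^sup>2) * (exp (- H s) * - (?h + ?k))) (at s)"
      unfolding E_def by (rule derivative_eq_intros U'[OF s] V'[OF s] H' refl)+ (simp add: algebra_simps)
    moreover have "(2 * ?u * - (?h * ?v) + 2 * ?v * - (?k * ?u)) * exp (- H s)
        + (?u\<^sup>2 + ?v\<^sup>2) * (exp (- H s) * - (?h + ?k)) = - ((?u + ?v)\<^sup>2 * (?h + ?k) * exp (- H s))"
      by (simp add: power2_eq_square algebra_simps)
    ultimately show "\<exists>d. (E has_real_derivative d) (at s) \<and> d \<le> 0"
      by (intro exI[of _ "- ((?u + ?v)\<^sup>2 * (?h + ?k) * exp (- H s))"]) simp
  qed
  then have "eventually (\<lambda>x. E y \<le> E x) (at_right 0)"
    using y by (auto simp: eventually_at_right_field intro!: exI[of _ y])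
  with E0 have "E y \<le> 0"
    by (rule tendsto_lowerbound) simp
  moreover have "E y \<ge> 0" by (simp add: E_def)
  ultimately have "E y = 0" by (rule antisym)
  then have "(U y)\<^sup>2 + (V y)\<^sup>2 = 0" by (simp add: E_def)
  then show ?thesis by (simp add: sum_power2_eq_zero_iff)
qed

text \<open>
  The difference \<open>D a\<close> of the two families satisfies \<open>D a' = - D (a - 1)\<close> and
  \<open>D (- a) y = y powr (- a) * D a y\<close>.  For \<open>0 < b < 1\<close> these close up to a first-order system
  for \<open>D b\<close> and \<open>D (1 - b)\<close>, both of which vanish at \<open>0\<close>; hence \<open>D b = 0\<close>.  Differentiation
  lowers the order by one and so reaches every negative noninteger order, and reflection gives the
  positive ones.
\<close>

lemma macdonald_series_eq_extended_Gamma: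
  assumes "a \<notin> \<int>" "y > 0"
  shows "macdonald_series a y = extended_Gamma a y"
proof -
  define D where "D a y = macdonald_series a y - extended_Gamma a y" for a y
  have reflect: "D (- b) y = y powr (- b) * D b y" if "y > 0" for b y
    using that by (simp add: D_def macdonald_series_reflect extended_Gamma_reflect algebra_simps)
  have deriv: "(D b has_real_derivative - D (b - 1) y) (at y)" if "y > 0" for b y
    using DERIV_diff[OF DERIV_macdonald_series DERIV_extended_Gamma] that
    by (simp add: D_def[abs_def])
  have lim: "(D b \<longlongrightarrow> 0) (at_right 0)" if "0 < b" "b < 1" for b
    using tendsto_diff[OF tendsto_macdonald_series_0[of b] tendsto_extended_Gamma_0[of b]] that
    by (simp add: D_def[abs_def])
  have base: "D b y = 0" if "0 < b" "b < 1" "y > 0" for b y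
    by (rule coupled_system_zero_at_0[of "D b" b "D (1 - b)"])
       (use that reflect[of _ "1 - b"] reflect[of _ b] deriv[of _ b] deriv[of _ "1 - b"] lim in simp_all)
  have down: "D (b - 1) y = 0" if "\<And>y. y > 0 \<Longrightarrow> D b y = 0" "y > 0" for b y
  proof -
    have "((\<lambda>_. 0) has_real_derivative - D (b - 1) y) (at y)"
      by (rule has_field_derivative_transform_within_open[OF deriv[OF that(2)], of "{0<..}"])
         (use that in auto)
    then show ?thesis
      using DERIV_unique[OF _ DERIV_const[of 0 "at y"]] by fastforce
  qed
  have ladder: "D (b - real n) y = 0" if "0 < b" "b < 1" "y > 0" for b y n
    using that(3)
  proof (induction n arbitrary: y)
    case 0
    with base that show ?case by simp
  next
    case (Suc n)
    with down[of "b - real n"] show ?case by (simp add: algebra_simps)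
  qed
  have neg: "D b y = 0" if "b < 0" "b \<notin> \<int>" for b
  proof -
    have "frac b > 0" using that(2) by (simp add: frac_gt_0_iff)
    moreover have "b = frac b - real (nat (- \<lfloor>b\<rfloor>))"
      using that(1) by (simp add: frac_def)
    ultimately show ?thesis using ladder[of "frac b" y "nat (- \<lfloor>b\<rfloor>)"] frac_lt_1[of b] assms(2) by metis
  qed
  have "D a y = 0"
  proof (cases "a < 0")
    case False
    moreover have "a \<noteq> 0" using assms(1) by auto
    ultimately have "D (- a) y = 0" using assms by (intro neg) auto
    then show ?thesis using reflect[OF assms(2), of a] assms(2) by simp
  qed (use neg assms in simp)
  then show ?thesis by (simp add: D_def)
qed

text \<open>
  At an integer order the series identity holds on a punctured neighbourhood, and continuity of
  \<open>extended_Gamma\<close> in the order evaluates the limit that defines \<open>mcdonald_K\<close>.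
\<close>

theorem mcdonald_K_eq_extended_Gamma:
  assumes "z > 0"
  shows "mcdonald_K \<nu> z = 1 / 2 * (z / 2) powr (- \<nu>) * extended_Gamma \<nu> (z\<^sup>2 / 4)"
proof (cases "\<nu> \<in> \<int>")
  case False
  then show ?thesis
    using assms by (simp add: mcdonald_K_def mcdonald_quotient_eq macdonald_series_eq_extended_Gamma)
next
  case True
  let ?G = "\<lambda>\<alpha>. 1 / 2 * (z / 2) powr (- \<alpha>) * extended_Gamma \<alpha> (z\<^sup>2 / 4)"
  have "isCont ?G \<nu>"
    using assms by (intro continuous_intros isCont_extended_Gamma_order) auto
  then have "(?G \<longlongrightarrow> ?G \<nu>) (at \<nu>)" by (simp add: isCont_def)
  moreover have "eventually (\<lambda>\<alpha>. \<alpha> \<notin> \<int>) (at \<nu>)"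
  proof -
    from True obtain n where n: "\<nu> = of_int n" by (auto elim: Ints_cases)
    have "\<alpha> \<notin> \<int>" if "\<alpha> \<noteq> \<nu>" "dist \<alpha> \<nu> < 1" for \<alpha>
      using that by (auto elim!: Ints_cases simp: n dist_real_def)
    then show ?thesis by (auto simp: eventually_at intro!: exI[of _ 1])
  qed
  then have "eventually (\<lambda>\<alpha>. mcdonald_quotient \<alpha> z = ?G \<alpha>) (at \<nu>)"
    by eventually_elim (use assms in \<open>simp add: mcdonald_quotient_eq macdonald_series_eq_extended_Gamma\<close>)
  ultimately have "((\<lambda>\<alpha>. mcdonald_quotient \<alpha> z) \<longlongrightarrow> ?G \<nu>) (at \<nu>)"
    using tendsto_cong by fast
  then have "Lim (at \<nu>) (\<lambda>\<alpha>. mcdonald_quotient \<alpha> z) = ?G \<nu>"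
    by (intro tendsto_Lim) simp_all
  with True show ?thesis by (simp add: mcdonald_K_def)
qed

section \<open>Basset's integral\<close>

text \<open>
  Writes \<open>exp (- r)\<close> as a mixture of the Gaussians \<open>exp (- r\<^sup>2 / (4 * u))\<close>.  Order \<open>- 1 / 2\<close>
  is chosen for the factor \<open>r\<close> in front: it is what makes the Gaussian integral in
  Basset's formula elementary.
\<close>

lemma exp_minus_eq_extended_Gamma:
  assumes "r > 0"
  shows "exp (- r) = r / (2 * sqrt pi) * extended_Gamma (- 1 / 2) (r\<^sup>2 / 4)"
proof -
  have root: "sqrt (r\<^sup>2 / 4) = r / 2" using assms by (simp add: real_sqrt_divide)
  have "extended_Gamma (- 1 / 2) (r\<^sup>2 / 4)
      = inverse (sqrt (r\<^sup>2 / 4)) * (sqrt pi * exp (- 2 * sqrt (r\<^sup>2 / 4)))"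
    using extended_Gamma_reflect[of "r\<^sup>2 / 4" "1 / 2"] extended_Gamma_half[of "r\<^sup>2 / 4"] assms
    by (simp add: powr_minus powr_half_sqrt)
  also have "\<dots> = 2 / r * (sqrt pi * exp (- r))"
    unfolding root by simp
  finally have "extended_Gamma (- 1 / 2) (r\<^sup>2 / 4) = 2 / r * (sqrt pi * exp (- r))" .
  then show ?thesis using assms by (simp add: field_simps)
qed

text \<open>
  The substitution \<open>w = b * (\<tau>\<^sup>2 - a\<^sup>2)\<close>, whose derivative provides the factor \<open>\<tau>\<close>.
\<close>

lemma nn_integral_quadratic_Gamma:
  assumes "b > 0" "a > 0" "\<beta> > 0"
  shows "(\<integral>\<^sup>+\<tau>\<in>{a<..}. ennreal (\<tau> * (\<tau>\<^sup>2 - a\<^sup>2) powr (\<beta> - 1) * exp (- b * (\<tau>\<^sup>2 - a\<^sup>2))) \<partial>lborel)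
    = ennreal (Gamma \<beta> / (2 * b powr \<beta>))"
proof -
  let ?g = "\<lambda>\<tau>. b * (\<tau>\<^sup>2 - a\<^sup>2)" and ?f = "\<lambda>w. w powr (\<beta> - 1) * exp (- w) / (2 * b powr \<beta>)"
  have sq: "a\<^sup>2 < \<tau>\<^sup>2" if "a < \<tau>" for \<tau>
    using that assms by (simp add: power_strict_mono)
  have img: "?g ` {a<..} = {0<..}"
  proof (intro equalityI subsetI)
    fix w :: real assume "w \<in> {0<..}"
    then have w: "w > 0" by simp
    have "a < sqrt (w / b + a\<^sup>2)"
      using w assms by (intro real_less_rsqrt) simp
    moreover have "w = ?g (sqrt (w / b + a\<^sup>2))"
      using w assms by simp
    ultimately show "w \<in> ?g ` {a<..}" by blast
  qed (use sq assms in auto)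
  have "(\<integral>\<^sup>+\<tau>\<in>{a<..}. ennreal (\<tau> * (\<tau>\<^sup>2 - a\<^sup>2) powr (\<beta> - 1) * exp (- b * (\<tau>\<^sup>2 - a\<^sup>2))) \<partial>lborel)
      = (\<integral>\<^sup>+\<tau>\<in>{a<..}. ennreal (\<bar>2 * b * \<tau>\<bar> * ?f (?g \<tau>)) \<partial>lborel)"
  proof (intro nn_integral_cong)
    fix \<tau> :: real
    have "\<tau> * (\<tau>\<^sup>2 - a\<^sup>2) powr (\<beta> - 1) * exp (- b * (\<tau>\<^sup>2 - a\<^sup>2)) = \<bar>2 * b * \<tau>\<bar> * ?f (?g \<tau>)" if "a < \<tau>"
    proof -
      have "?g \<tau> powr (\<beta> - 1) = b powr \<beta> / b * (\<tau>\<^sup>2 - a\<^sup>2) powr (\<beta> - 1)"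
        using assms sq[OF that] by (subst powr_mult) (simp_all add: powr_diff)
      then show ?thesis using that assms by (simp add: abs_mult)
    qed
    then show "ennreal (\<tau> * (\<tau>\<^sup>2 - a\<^sup>2) powr (\<beta> - 1) * exp (- b * (\<tau>\<^sup>2 - a\<^sup>2))) * indicator {a<..} \<tau>
        = ennreal (\<bar>2 * b * \<tau>\<bar> * ?f (?g \<tau>)) * indicator {a<..} \<tau>"
      by (auto simp: indicator_def)
  qed
  also have "\<dots> = (\<integral>\<^sup>+w\<in>?g ` {a<..}. ennreal (?f w) \<partial>lborel)"
  proof (rule nn_integral_change_of_variables_real[symmetric])
    show "?g ` {a<..} \<in> sets borel" by (simp only: img) simp
    show "inj_on ?g {a<..}"
      using assms by (auto simp: inj_on_def power2_eq_iff)
    show "(?g has_real_derivative 2 * b * \<tau>) (at \<tau>)" for \<tau>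
      by (auto intro!: derivative_eq_intros)
  qed simp_all
  also have "\<dots> = (\<integral>\<^sup>+w. ennreal (1 / (2 * b powr \<beta>)) * ennreal (indicator {0..} w * w powr (\<beta> - 1) / exp w) \<partial>lborel)"
    unfolding img
    by (intro nn_integral_cong) (auto simp: indicator_def exp_minus field_simps simp flip: ennreal_mult)
  also have "\<dots> = ennreal (Gamma \<beta> / (2 * b powr \<beta>))"
    using assms
    by (subst nn_integral_cmult, simp, subst Gamma_conv_nn_integral_real[OF assms(3), symmetric])
       (simp flip: ennreal_mult')
  finally show ?thesis .
qed

text \<open>
  Replace \<open>exp (- s * \<tau>)\<close> by its Gaussian mixture and integrate over \<open>\<tau>\<close> first, which is allowed
  since everything is nonnegative.  The inner integral is a Gamma value times
  \<open>u powr (\<nu> - 1) * exp (- u - y / u)\<close>, so the outer one is again an extended Gamma function,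
  now of order \<open>\<nu>\<close>.
\<close>

lemma nn_integral_Basset:
  assumes "s > 0" "a > 0" "\<nu> > - 1 / 2"
  shows "(\<integral>\<^sup>+\<tau>\<in>{a<..}. ennreal (exp (- s * \<tau>) * (\<tau>\<^sup>2 - a\<^sup>2) powr (\<nu> - 1 / 2)) \<partial>lborel)
    = ennreal (Gamma (\<nu> + 1 / 2) / sqrt pi * (2 * a / s) powr \<nu> * mcdonald_K \<nu> (s * a))"
proof -
  let ?b = "\<lambda>u. s\<^sup>2 / (4 * u)"
  define y where "y = (s * a)\<^sup>2 / 4"
  \<comment> \<open>\<open>u\<close> is the mixing variable; \<open>exp (- (s * \<tau>)\<^sup>2 / (4 * u))\<close> is split at \<open>\<tau> = a\<close>, where it
      equals \<open>exp (- y / u)\<close>\<close>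
  define F where "F \<tau> u = ennreal (s / (2 * sqrt pi) * u powr (- 3 / 2) * exp (- u - y / u)
    * (\<tau> * (\<tau>\<^sup>2 - a\<^sup>2) powr (\<nu> - 1 / 2) * exp (- ?b u * (\<tau>\<^sup>2 - a\<^sup>2))))
    * indicator {0<..} u * indicator {a<..} \<tau>" for \<tau> u
  define C where "C = Gamma (\<nu> + 1 / 2) * (2 / s) powr (2 * \<nu>) / (2 * sqrt pi)"
  have C0: "C \<ge> 0" unfolding C_def using assms by simp
  have y: "y > 0" using assms by (simp add: y_def)
  have outer: "ennreal (exp (- s * \<tau>) * (\<tau>\<^sup>2 - a\<^sup>2) powr (\<nu> - 1 / 2)) * indicator {a<..} \<tau> = (\<integral>\<^sup>+u. F \<tau> u \<partial>lborel)" for \<tau>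
  proof (cases "a < \<tau>")
    case True
    then have st: "s * \<tau> > 0" using assms by simp
    then have pos: "(s * \<tau>)\<^sup>2 / 4 > 0" by (simp only: zero_less_power zero_less_divide_iff) simp
    let ?W = "(\<tau>\<^sup>2 - a\<^sup>2) powr (\<nu> - 1 / 2)"
    have "F \<tau> u = ennreal (s * \<tau> / (2 * sqrt pi) * ?W) *
        (ennreal (u powr (- 1 / 2 - 1) * exp (- u - (s * \<tau>)\<^sup>2 / 4 / u)) * indicator {0<..} u)" for u
    proof (cases "u > 0")
      case u: True
      let ?A = "s * \<tau> / (2 * sqrt pi) * ?W" and ?B = "u powr (- 1 / 2 - 1) * exp (- u - (s * \<tau>)\<^sup>2 / 4 / u)"
      have "exp (- u - y / u) * exp (- ?b u * (\<tau>\<^sup>2 - a\<^sup>2)) = exp (- u - (s * \<tau>)\<^sup>2 / 4 / u)"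
        using u by (simp add: y_def power_mult_distrib field_simps flip: exp_add)
      then have AB: "?A * ?B = s / (2 * sqrt pi) * u powr (- 3 / 2) * exp (- u - y / u)
            * (\<tau> * ?W * exp (- ?b u * (\<tau>\<^sup>2 - a\<^sup>2)))"
        by (simp add: mult_ac)
      have "F \<tau> u = ennreal (?A * ?B)"
        unfolding AB using True u by (simp add: F_def)
      also have "\<dots> = ennreal ?A * (ennreal ?B * indicator {0<..} u)"
        using u st by (subst ennreal_mult) simp_all
      finally show ?thesis .
    qed (simp add: F_def)
    then have "(\<integral>\<^sup>+u. F \<tau> u \<partial>lborel) = ennreal (s * \<tau> / (2 * sqrt pi) * ?W) * ennreal (extended_Gamma (- 1 / 2) ((s * \<tau>)\<^sup>2 / 4))"
      unfolding nn_integral_extended_Gamma[OF pos, symmetric] by (simp only:) (rule nn_integral_cmult, simp)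
    also have "\<dots> = ennreal (exp (- (s * \<tau>)) * ?W)"
    proof -
      have "0 \<le> s * \<tau> / (2 * sqrt pi) * ?W"
        using True assms by (intro mult_nonneg_nonneg divide_nonneg_nonneg) auto
      then show ?thesis
        unfolding exp_minus_eq_extended_Gamma[OF st]
        by (subst ennreal_mult'[symmetric]) (assumption, simp add: mult_ac)
    qed
    finally show ?thesis using True by simp
  qed (simp add: F_def)
  have inner: "(\<integral>\<^sup>+\<tau>. F \<tau> u \<partial>lborel) = ennreal C * (ennreal (u powr (\<nu> - 1) * exp (- u - y / u)) * indicator {0<..} u)" for u
  proof (cases "u > 0")
    case True
    let ?c = "s / (2 * sqrt pi) * u powr (- 3 / 2) * exp (- u - y / u)"
    have "F \<tau> u = ennreal ?c *
        (ennreal (\<tau> * (\<tau>\<^sup>2 - a\<^sup>2) powr (\<nu> + 1 / 2 - 1) * exp (- ?b u * (\<tau>\<^sup>2 - a\<^sup>2))) * indicator {a<..} \<tau>)" for \<tau>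
      using True assms by (auto simp: F_def indicator_def simp flip: ennreal_mult)
    then have "(\<integral>\<^sup>+\<tau>. F \<tau> u \<partial>lborel) = ennreal ?c * ennreal (Gamma (\<nu> + 1 / 2) / (2 * ?b u powr (\<nu> + 1 / 2)))"
      using True assms nn_integral_quadratic_Gamma[of "?b u" a "\<nu> + 1 / 2"] by (simp add: nn_integral_cmult)
    also have "\<dots> = ennreal (C * (u powr (\<nu> - 1) * exp (- u - y / u)))"
    proof -
      have "?b u powr (\<nu> + 1 / 2) = (s / 2) powr (2 * \<nu> + 1) / u powr (\<nu> + 1 / 2)"
      proof -
        have "?b u = (s / 2) powr 2 / u" using assms by (simp add: powr_numeral power_divide)
        then have "?b u powr (\<nu> + 1 / 2) = ((s / 2) powr 2) powr (\<nu> + 1 / 2) / u powr (\<nu> + 1 / 2)"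
          using True by (simp only: powr_divide powr_ge_zero less_imp_le)
        also have "((s / 2) powr 2) powr (\<nu> + 1 / 2) = (s / 2) powr (2 * \<nu> + 1)"
          by (simp only: powr_powr) (simp add: distrib_left)
        finally show ?thesis .
      qed
      also have "(s / 2) powr (2 * \<nu> + 1) = s / 2 / (2 / s) powr (2 * \<nu>)"
        using assms by (simp add: powr_add powr_divide mult_ac)
      finally have b: "?b u powr (\<nu> + 1 / 2) = s / 2 / (2 / s) powr (2 * \<nu>) / u powr (\<nu> + 1 / 2)" .
      have u: "u powr (- 3 / 2) * u powr (\<nu> + 1 / 2) = u powr (\<nu> - 1)"
        by (simp flip: powr_add)
      have "?c * (Gamma (\<nu> + 1 / 2) / (2 * ?b u powr (\<nu> + 1 / 2)))
          = C * ((u powr (- 3 / 2) * u powr (\<nu> + 1 / 2)) * exp (- u - y / u))"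
        unfolding b C_def using assms True by (simp add: field_simps)
      then show ?thesis using assms True unfolding u by (simp flip: ennreal_mult')
    qed
    finally show ?thesis using True C0 by (simp add: ennreal_mult)
  qed (simp add: F_def)
  have "(\<lambda>(\<tau>, u). F \<tau> u) \<in> borel_measurable (lborel \<Otimes>\<^sub>M lborel)"
    unfolding F_def by measurable
  then have "(\<integral>\<^sup>+\<tau>. (\<integral>\<^sup>+u. F \<tau> u \<partial>lborel) \<partial>lborel) = (\<integral>\<^sup>+u. (\<integral>\<^sup>+\<tau>. F \<tau> u \<partial>lborel) \<partial>lborel)"
    by (rule lborel_pair.Fubini'[symmetric])
  also have "\<dots> = ennreal C * ennreal (extended_Gamma \<nu> y)"
    unfolding inner using nn_integral_extended_Gamma[OF y, of \<nu>] by (simp add: nn_integral_cmult)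
  also have "\<dots> = ennreal (C * extended_Gamma \<nu> y)"
    using C0 by (simp add: extended_Gamma_nonneg ennreal_mult)
  also have "C * extended_Gamma \<nu> y = Gamma (\<nu> + 1 / 2) / sqrt pi * (2 * a / s) powr \<nu> * mcdonald_K \<nu> (s * a)"
  proof -
    have "2 / s * (2 / s) = 2 * a / s * (1 / (s * a / 2))"
      using assms by (simp add: field_simps)
    then have "(2 / s) powr \<nu> * (2 / s) powr \<nu> = (2 * a / s) powr \<nu> * (1 / (s * a / 2)) powr \<nu>"
      using assms by (simp only: powr_mult[symmetric])
    also have "(1 / (s * a / 2)) powr \<nu> = (s * a / 2) powr (- \<nu>)"
      by (simp only: powr_divide powr_one_eq_one powr_minus_divide)
    also have "(2 / s) powr \<nu> * (2 / s) powr \<nu> = (2 / s) powr (2 * \<nu>)"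
      by (simp only: mult_2 powr_add)
    finally have pow: "(2 / s) powr (2 * \<nu>) = (2 * a / s) powr \<nu> * (s * a / 2) powr (- \<nu>)" .
    have K: "mcdonald_K \<nu> (s * a) = 1 / 2 * (s * a / 2) powr (- \<nu>) * extended_Gamma \<nu> y"
      unfolding y_def using assms by (intro mcdonald_K_eq_extended_Gamma) simp
    show ?thesis unfolding C_def pow K by simp
  qed
  finally show ?thesis unfolding outer .
qed

lemma mcdonald_K_nonneg: "z > 0 \<Longrightarrow> mcdonald_K \<nu> z \<ge> 0"
  by (simp add: mcdonald_K_eq_extended_Gamma extended_Gamma_nonneg)

section \<open>Expansion of the stationary density\<close>

text \<open>
  Expand \<open>exp (lam * q)\<close> with \<open>q = sqrt (\<tau>\<^sup>2 - a\<^sup>2)\<close> and integrate termwise by monotone convergence;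
  the \<open>k\<close>-th term is Basset's integral of order \<open>k / 2\<close>.  Convergence is read off the integral:
  \<open>q \<le> \<tau>\<close> bounds the integrand by that of order \<open>0\<close> with the rate \<open>s - lam > 0\<close>.
\<close>

lemma sums_exp_sqrt_Laplace:
  fixes a s lam :: real
  assumes "a > 0" "lam > 0" "lam < s"
  shows "(\<lambda>k. lam ^ k / fact k * (Gamma ((real k + 1) / 2) / sqrt pi * (2 * a / s) powr (real k / 2)
            * mcdonald_K (real k / 2) (s * a)))
     sums (LBINT \<tau>:{a..}. exp (- s * \<tau>) * (exp (lam * sqrt (\<tau>\<^sup>2 - a\<^sup>2)) / sqrt (\<tau>\<^sup>2 - a\<^sup>2)))"
    (is "?T sums _")
proof -
  let ?q = "\<lambda>\<tau>. sqrt (\<tau>\<^sup>2 - a\<^sup>2)"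
  let ?I = "\<lambda>k \<tau>. exp (- s * \<tau>) * (\<tau>\<^sup>2 - a\<^sup>2) powr (real k / 2 - 1 / 2)"
  let ?f = "\<lambda>\<tau>. indicator {a..} \<tau> * (exp (- s * \<tau>) * (exp (lam * ?q \<tau>) / ?q \<tau>))"
  have T0: "?T k \<ge> 0" for k
    using assms by (simp add: mcdonald_K_nonneg)
  have q: "\<tau>\<^sup>2 - a\<^sup>2 > 0" if "a < \<tau>" for \<tau>
    using that assms by (simp add: power_strict_mono)
  \<comment> \<open>at \<open>\<tau> = a\<close> the integrand is a division by \<open>0\<close> and vanishes, so that closed and open
      half-lines agree pointwise\<close>
  have f0: "?f \<tau> \<ge> 0" for \<tau>
    using q[of \<tau>] by (cases "\<tau> = a") (auto simp: indicator_def)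
  have T: "ennreal (?T k) = ennreal (lam ^ k / fact k) * (\<integral>\<^sup>+\<tau>\<in>{a<..}. ennreal (?I k \<tau>) \<partial>lborel)" for k
  proof -
    have k: "real k / 2 + 1 / 2 = (real k + 1) / 2" by simp
    have B: "(\<integral>\<^sup>+\<tau>\<in>{a<..}. ennreal (?I k \<tau>) \<partial>lborel) = ennreal (Gamma ((real k + 1) / 2) / sqrt pi
        * (2 * a / s) powr (real k / 2) * mcdonald_K (real k / 2) (s * a))"
      by (rule nn_integral_Basset[of s a "real k / 2", unfolded k]) (use assms in auto)
    show ?thesis unfolding B by (rule ennreal_mult') (use assms in simp)
  qed
  have f: "ennreal (?f \<tau>) = (\<Sum>k. ennreal (lam ^ k / fact k) * (ennreal (?I k \<tau>) * indicator {a<..} \<tau>))" for \<tau>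
  proof (cases "a < \<tau>")
    case True
    have I: "?I k \<tau> = exp (- s * \<tau>) * (?q \<tau> ^ k / ?q \<tau>)" for k
    proof -
      have "(\<tau>\<^sup>2 - a\<^sup>2) powr (real k / 2 - 1 / 2) = ((\<tau>\<^sup>2 - a\<^sup>2) powr (1 / 2)) powr real k / (\<tau>\<^sup>2 - a\<^sup>2) powr (1 / 2)"
        using q[OF True] by (simp add: powr_diff powr_powr)
      then show ?thesis
        using q[OF True] by (simp add: powr_half_sqrt powr_realpow)
    qed
    have "(\<lambda>k. exp (- s * \<tau>) / ?q \<tau> * ((lam * ?q \<tau>) ^ k /\<^sub>R fact k)) sums (exp (- s * \<tau>) / ?q \<tau> * exp (lam * ?q \<tau>))"
      by (intro sums_mult exp_converges)
    moreover have "(\<lambda>k. exp (- s * \<tau>) / ?q \<tau> * ((lam * ?q \<tau>) ^ k /\<^sub>R fact k)) = (\<lambda>k. lam ^ k / fact k * ?I k \<tau>)"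
      unfolding I by (simp add: fun_eq_iff power_mult_distrib field_simps)
    ultimately have "(\<lambda>k. lam ^ k / fact k * ?I k \<tau>) sums ?f \<tau>"
      using True by simp
    then have "ennreal (?f \<tau>) = (\<Sum>k. ennreal (lam ^ k / fact k * ?I k \<tau>))"
      using assms suminf_ennreal2[of "\<lambda>k. lam ^ k / fact k * ?I k \<tau>"]
      unfolding sums_iff by (metis (no_types, lifting) divide_nonneg_pos exp_ge_zero fact_gt_zero less_imp_le
          mult_nonneg_nonneg powr_ge_zero zero_le_power)
    moreover have "ennreal (lam ^ k / fact k * ?I k \<tau>)
        = ennreal (lam ^ k / fact k) * (ennreal (?I k \<tau>) * indicator {a<..} \<tau>)" for k
      using True assms by (subst ennreal_mult') auto
    ultimately show ?thesis by (simp only:)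
  qed (auto simp: indicator_def)
  have nn: "(\<integral>\<^sup>+\<tau>. ennreal (?f \<tau>) \<partial>lborel) = (\<Sum>k. ennreal (?T k))"
    unfolding f T by (subst nn_integral_suminf) (simp_all add: nn_integral_cmult)
  have fin: "(\<integral>\<^sup>+\<tau>. ennreal (?f \<tau>) \<partial>lborel) < \<infinity>"
  proof -
    have "(\<integral>\<^sup>+\<tau>. ennreal (?f \<tau>) \<partial>lborel)
        \<le> (\<integral>\<^sup>+\<tau>\<in>{a<..}. ennreal (exp (- (s - lam) * \<tau>) * (\<tau>\<^sup>2 - a\<^sup>2) powr (0 - 1 / 2)) \<partial>lborel)"
    proof (intro nn_integral_mono)
      fix \<tau> :: real
      show "ennreal (?f \<tau>) \<le> ennreal (exp (- (s - lam) * \<tau>) * (\<tau>\<^sup>2 - a\<^sup>2) powr (0 - 1 / 2)) * indicator {a<..} \<tau>"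
      proof (cases "a < \<tau>")
        case True
        have "?q \<tau> \<le> \<tau>" using True assms by (intro real_le_lsqrt) auto
        then have "exp (- s * \<tau>) * exp (lam * ?q \<tau>) \<le> exp (- (s - lam) * \<tau>)"
          using assms by (simp add: algebra_simps flip: exp_add)
        then show ?thesis
          using True q[OF True] by (simp add: powr_minus powr_half_sqrt ennreal_leI divide_right_mono flip: divide_inverse)
      qed (auto simp: indicator_def)
    qed
    also have "\<dots> < \<infinity>"
      by (subst nn_integral_Basset) (use assms in auto)
    finally show ?thesis .
  qed
  have "summable ?T"
    by (rule summable_suminf_not_top) (use T0 fin nn in auto)
  moreover have "(LBINT \<tau>:{a..}. exp (- s * \<tau>) * (exp (lam * ?q \<tau>) / ?q \<tau>)) = suminf ?T"
  proof -
    have "(LBINT \<tau>:{a..}. exp (- s * \<tau>) * (exp (lam * ?q \<tau>) / ?q \<tau>)) = enn2real (\<Sum>k. ennreal (?T k))"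
      unfolding nn[symmetric] set_lebesgue_integral_def real_scaleR_def
      by (intro integral_eq_nn_integral) (use f0 in auto)
    then show ?thesis
      using T0 \<open>summable ?T\<close> by (simp add: suminf_ennreal2 suminf_nonneg)
  qed
  ultimately show ?thesis by (simp add: sums_iff)
qed

text \<open>
  With \<open>a = norm x / c\<close> the square root in the density is \<open>c * sqrt (\<tau>\<^sup>2 - a\<^sup>2)\<close>, which yields one
  of the two factors \<open>1 / c\<close>; the factor \<open>sqrt pi\<close> comes from Basset's formula.
\<close>

theorem theorem1:
  fixes lam \<mu> c :: real and x :: "real ^ 2"
  assumes "lam > 0" and "\<mu> > 0" and "c > 0" and "x \<noteq> 0"
  shows "summable (\<lambda>k. lam ^ k / fact k * Gamma ((real k + 1) / 2) *
           (2 * norm x / (c * (lam + \<mu>))) powr (real k / 2) *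
           mcdonald_K (real k / 2) ((lam + \<mu>) * (norm x / c))) \<and>
         p_h c lam \<mu> x = lam * \<mu> / (2 * pi powr (3 / 2) * c\<^sup>2) *
           (\<Sum>k. lam ^ k / fact k * Gamma ((real k + 1) / 2) *
             (2 * norm x / (c * (lam + \<mu>))) powr (real k / 2) *
             mcdonald_K (real k / 2) ((lam + \<mu>) * (norm x / c)))"
    (is "summable ?t \<and> _")
proof -
  define a where "a = norm x / c"
  define s where "s = lam + \<mu>"
  define J where "J = (LBINT \<tau>:{a..}. exp (- s * \<tau>) * (exp (lam * sqrt (\<tau>\<^sup>2 - a\<^sup>2)) / sqrt (\<tau>\<^sup>2 - a\<^sup>2)))"
  have a: "a > 0" and s: "lam < s" using assms by (simp_all add: a_def s_def)
  have "(\<lambda>k. sqrt pi * (lam ^ k / fact k * (Gamma ((real k + 1) / 2) / sqrt pi * (2 * a / s) powr (real k / 2)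
            * mcdonald_K (real k / 2) (s * a)))) sums (sqrt pi * J)"
    unfolding J_def by (intro sums_mult sums_exp_sqrt_Laplace a s assms)
  moreover have "?t = (\<lambda>k. sqrt pi * (lam ^ k / fact k * (Gamma ((real k + 1) / 2) / sqrt pi * (2 * a / s) powr (real k / 2)
            * mcdonald_K (real k / 2) (s * a))))"
  proof -
    have "2 * norm x / (c * s) = 2 * a / s" by (simp add: a_def)
    then show ?thesis
      unfolding s_def[symmetric] a_def[symmetric] by (simp add: fun_eq_iff)
  qed
  ultimately have t: "?t sums (sqrt pi * J)"
    by simp
  have "p_h c lam \<mu> x = lam * \<mu> / (2 * pi * c) * (J / c)"
  proof -
    have sqrt: "sqrt (c\<^sup>2 * \<tau>\<^sup>2 - (norm x)\<^sup>2) = c * sqrt (\<tau>\<^sup>2 - a\<^sup>2)" for \<tau>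
    proof -
      have "c\<^sup>2 * \<tau>\<^sup>2 - (norm x)\<^sup>2 = c\<^sup>2 * (\<tau>\<^sup>2 - a\<^sup>2)"
        using assms by (simp add: a_def power_divide right_diff_distrib)
      then show ?thesis using assms by (simp add: real_sqrt_mult)
    qed
    have "exp (- s * \<tau>) * (exp (lam / c * (c * q)) / (c * q)) = exp (- s * \<tau>) * (exp (lam * q) / q) / c" for \<tau> q
      using assms by simp
    then show ?thesis
      unfolding p_h_eq_integral[OF assms(1-3)] sqrt a_def[symmetric] s_def[symmetric] J_def
      by (simp only: set_integral_divide_zero)
  qed
  moreover have "pi powr (3 / 2) = pi * sqrt pi"
    using powr_add[of pi 1 "1 / 2"] by (simp add: powr_half_sqrt)
  ultimately have "p_h c lam \<mu> x = lam * \<mu> / (2 * pi powr (3 / 2) * c\<^sup>2) * (sqrt pi * J)"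
    by (simp add: power2_eq_square)
  with t show ?thesis by (simp add: sums_iff)
qed

end
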